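(* Let $G$ and $H$ be two graphs on the same vertex set $V$ with $E(G)\cap E(H)=\emptyset$, and let $G+H$ be the graph with vertex set $V$ and edge set $E(G)\cup E(H)$. Then $\mathrm{USN}(G+H)\le \mathrm{USN}(G)\cdot \mathrm{USN}(H)$.
   Context: Graphs are finite, simple and undirected. A valid labelling of a graph $G$ with universe a finite set $S$ assigns to the vertices of $G$ pairwise distinct nonempty subsets of $S$ such that two distinct vertices are adjacent if and only if their labels are disjoint. The universe size number $\mathrm{USN}(G)$ is the minimum of $|S|$ over all finite sets $S$ for which $G$ has a valid labelling with universe $S$. *)

theory Defs
  imports "Graph_Theory.Pair_Digraph"
begin

text \<open>
  A finite simple undirected graph is a \<^locale>\<open>pair_graph\<close>: a finite loop-free digraph with
  a symmetric arc set, so that an edge between u and v is the pair of arcs (u, v) and (v, u).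
  Two such graphs have disjoint edge sets iff their arc sets are disjoint, and the union of
  the edge sets corresponds to the union of the arc sets.
\<close>

definition valid_labelling :: "'a pair_pre_digraph \<Rightarrow> 'b set \<Rightarrow> ('a \<Rightarrow> 'b set) \<Rightarrow> bool" where
  "valid_labelling G S L \<longleftrightarrow>
     finite S \<and>
     (\<forall>v\<in>pverts G. L v \<subseteq> S \<and> L v \<noteq> {}) \<and>
     inj_on L (pverts G) \<and>
     (\<forall>u\<in>pverts G. \<forall>v\<in>pverts G. u \<noteq> v \<longrightarrow> ((u, v) \<in> parcs G \<longleftrightarrow> L u \<inter> L v = {}))"

text \<open>
  Universes range over the finite sets of natural numbers. This loses no generality, see
  usn_le below; the minimum is attained for every finite simple graph, see usn_attained.
\<close>

definition usn :: "'a pair_pre_digraph \<Rightarrow> nat" where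
  "usn G = (LEAST n. \<exists>(S :: nat set) L. valid_labelling G S L \<and> card S = n)"

lemma valid_labelling_nat:
  assumes "valid_labelling G (S :: 'b set) L"
  shows "\<exists>(T :: nat set) M. valid_labelling G T M \<and> card T = card S"
proof -
  have fin: "finite S" using assms by (simp add: valid_labelling_def)
  obtain f :: "'b \<Rightarrow> nat" where f: "inj_on f S"
    using finite_imp_inj_to_nat_seg[OF fin] by blast
  have sub: "L v \<subseteq> S" if "v \<in> pverts G" for v
    using assms that by (simp add: valid_labelling_def)
  have "inj_on (\<lambda>v. f ` L v) (pverts G)"
  proof (rule inj_onI)
    fix u v assume uv: "u \<in> pverts G" "v \<in> pverts G" and "f ` L u = f ` L v"
    then have "L u = L v" using inj_on_image_eq_iff[OF f sub sub] by blast
    then show "u = v" using assms uv by (auto simp: valid_labelling_def dest: inj_onD)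
  qed
  moreover have "f ` L u \<inter> f ` L v = {} \<longleftrightarrow> L u \<inter> L v = {}"
    if "u \<in> pverts G" "v \<in> pverts G" for u v
    using inj_on_image_Int[OF f sub[OF that(1)] sub[OF that(2)]] by (metis image_is_empty)
  ultimately have "valid_labelling G (f ` S) (\<lambda>v. f ` L v)"
    using assms unfolding valid_labelling_def by (simp add: image_mono)
  then show ?thesis using card_image[OF f] by blast
qed

lemma usn_le:
  assumes "valid_labelling G (S :: 'b set) L"
  shows "usn G \<le> card S"
  unfolding usn_def using valid_labelling_nat[OF assms] by (rule Least_le)

lemma usn_attained:
  assumes "pair_graph G"
  shows "\<exists>(S :: nat set) L. valid_labelling G S L \<and> card S = usn G"
proof -
  interpret pair_graph G by fact
  let ?L = "\<lambda>v. {{v, w} | w. w \<in> pverts G \<and> (v, w) \<notin> parcs G}"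
  have loop: "(v, v) \<notin> parcs G" for v
    using no_loops' by blast
  have single: "{v} \<in> ?L u \<longleftrightarrow> u = v" if "u \<in> pverts G" "v \<in> pverts G" for u v
    using that loop by fastforce
  have "finite (Pow (pverts G))"
    using pair_finite_verts by simp
  moreover have "?L v \<subseteq> Pow (pverts G) \<and> ?L v \<noteq> {}" if "v \<in> pverts G" for v
    using single[OF that that] that by auto
  moreover have "inj_on ?L (pverts G)"
  proof (rule inj_onI)
    fix u v assume uv: "u \<in> pverts G" "v \<in> pverts G" and eq: "?L u = ?L v"
    have "{u} \<in> ?L u" by (rule single[OF uv(1) uv(1), THEN iffD2, OF refl])
    then have "{u} \<in> ?L v" by (subst eq [symmetric])
    then show "u = v" by (rule single[OF uv(2) uv(1), THEN iffD1, symmetric])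
  qed
  moreover have "(u, v) \<in> parcs G \<longleftrightarrow> ?L u \<inter> ?L v = {}"
    if "u \<in> pverts G" "v \<in> pverts G" "u \<noteq> v" for u v
  proof
    assume "(u, v) \<in> parcs G"
    then show "?L u \<inter> ?L v = {}"
      using that(3) arcs_symmetric by (auto simp: doubleton_eq_iff)
  next
    assume disjoint: "?L u \<inter> ?L v = {}"
    show "(u, v) \<in> parcs G"
    proof (rule ccontr)
      assume n: "(u, v) \<notin> parcs G"
      then have "(v, u) \<notin> parcs G" using arcs_symmetric by blast
      then have "{v, u} \<in> ?L v" using that(1) by blast
      moreover have "{v, u} \<in> ?L u" using n that(2) by (auto simp: insert_commute)
      ultimately have "{v, u} \<in> ?L u \<inter> ?L v" by (rule IntI[rotated])
      then show False unfolding disjoint by (rule emptyE)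
    qed
  qed
  ultimately have "valid_labelling G (Pow (pverts G)) ?L"
    unfolding valid_labelling_def by simp
  then have "\<exists>n (S :: nat set) L. valid_labelling G S L \<and> card S = n"
    using valid_labelling_nat by blast
  then show ?thesis
    unfolding usn_def by (rule LeastI_ex)
qed

end

theory Submission
  imports Defs
begin

text \<open>Label each vertex by the product of its labels in optimal labellings of \<open>G\<close>
  and \<open>H\<close>. Rectangles meet in the product of the intersections of their sides, so they
  are disjoint iff one pair of sides is: adjacency in the union. The universe
  \<open>S \<times> T\<close> has the required size.\<close>

text \<open>
  The product labels A v \<times> B v of labellings A of G and B of H are disjoint iff the labels
  are disjoint in one of the two factors.
\<close>

lemma valid_labelling_Times:
  assumes "valid_labelling \<lparr>pverts = V, parcs = E\<rparr> S A"
    and "valid_labelling \<lparr>pverts = V, parcs = F\<rparr> T B"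
  shows "valid_labelling \<lparr>pverts = V, parcs = E \<union> F\<rparr> (S \<times> T) (\<lambda>v. A v \<times> B v)"
proof -
  have "inj_on (\<lambda>v. A v \<times> B v) V"
  proof (rule inj_onI)
    fix u v assume uv: "u \<in> V" "v \<in> V" and "A u \<times> B u = A v \<times> B v"
    \<comment> \<open>Only a nonempty rectangle determines its sides.\<close>
    moreover have "A u \<noteq> {}" "B u \<noteq> {}"
      using assms uv by (auto simp: valid_labelling_def)
    ultimately have "A u = A v"
      by (auto simp: times_eq_iff)
    then show "u = v"
      using assms(1) uv by (auto simp: valid_labelling_def dest: inj_onD)
  qed
  moreover have "A u \<times> B u \<inter> A v \<times> B v = {} \<longleftrightarrow> A u \<inter> A v = {} \<or> B u \<inter> B v = {}" for u v
    by (simp add: Times_Int_Times)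
  ultimately show ?thesis
    using assms by (simp add: valid_labelling_def Sigma_mono)
qed

theorem theorem21:
  fixes G H :: "'a pair_pre_digraph" and V :: "'a set"
  assumes "pair_graph G" and "pair_graph H"
    and "pverts G = V" and "pverts H = V"
    and "parcs G \<inter> parcs H = {}"
  shows "usn \<lparr>pverts = V, parcs = parcs G \<union> parcs H\<rparr> \<le> usn G * usn H"
proof -
  obtain S :: "nat set" and A where A: "valid_labelling G S A" "card S = usn G"
    using usn_attained[OF assms(1)] by blast
  obtain T :: "nat set" and B where B: "valid_labelling H T B" "card T = usn H"
    using usn_attained[OF assms(2)] by blast
  have "valid_labelling \<lparr>pverts = V, parcs = parcs G \<union> parcs H\<rparr> (S \<times> T) (\<lambda>v. A v \<times> B v)"
    \<comment> \<open>Validity depends on a graph only through \<open>pverts\<close> and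
      \<open>parcs\<close>, so \<open>A\<close> and \<open>B\<close> also label the records over
      \<open>V\<close>.\<close>
    using A(1) B(1) assms(3,4) by (intro valid_labelling_Times) (simp_all add: valid_labelling_def)
  \<comment> \<open>\<open>usn_le\<close> accepts any universe type, here pairs of naturals.\<close>
  from usn_le[OF this] show ?thesis
    using A(2) B(2) by (simp add: card_cartesian_product)
qed

end
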